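(* Let $k\ge1$ and $n\ge1$. Let $\tau_n$ be a uniformly random $(k+1)$-ary increasing tree of order $n$ and $\sigma_n$ a uniformly random $k$-Stirling permutation of order $n$. Then \begin{align*} \mathbb{E}L_{n,j}&=\tfrac{kn+1}{k+1}, && 1\le j\le k+1,\\ \mathbb{E}D_{n,j}&=\tfrac{n-1}{k+1}, && 1\le j\le k+1,\\ \mathbb{E}X_{n,j}&=\mathbb{E}Y_{n,j}=\tfrac{n-1}{k+1}, && 1\le j\le k,\\ \mathbb{E}Z_{n,j}&=\tfrac{kn+1}{k+1}, && 1\le j\le k-1,\\ \mathbb{E}X_n&=\mathbb{E}Y_n=\tfrac{kn+1}{k+1},\\ \mathbb{E}Z_n&=(k-1)\tfrac{kn+1}{k+1}, \end{align*} where $L_{n,j},D_{n,j}$ refer to $\tau_n$ and $X_{n,j},Y_{n,j},Z_{n,j},X_n,Y_n,Z_n$ refer to $\sigma_n$.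
   Context: A $(k+1)$-ary increasing tree of order $n$ is a rooted tree on $\{1,\dots,n\}$, root $1$, labels increasing along paths away from the root, in which every vertex has $k+1$ positions numbered $1,\dots,k+1$, each empty or occupied by exactly one child, each non-root vertex occupying exactly one position of its parent. $D_{n,j}$ is the number of vertices occupying position $j$ of their parent; $L_{n,j}$ is the number of pairs (vertex $v$, position $j$ of $v$) with that position empty. A $k$-Stirling permutation of order $n$ is a word $a_1\cdots a_{kn}$ in which each of $1,\dots,n$ occurs exactly $k$ times, such that for each $i$ every entry between two occurrences of $i$ is at least $i$. Set $a_0=a_{kn+1}=0$. An index $i\in\{0,\dots,kn\}$ is an ascent if $a_i<a_{i+1}$, a descent if $a_i>a_{i+1}$, a plateau if $a_i=a_{i+1}$; $X_n,Y_n,Z_n$ are their total numbers. For $1\le i\le kn$: $i$ is a $j$-ascent if it is an ascent and $a_i$ is the $j$-th occurrence (from the left) of its value; a $j$-plateau if it is a plateau and $a_i$ is the $j$-th occurrence of its value; a $j$-descent if $i<kn$, $i$ is a descent and $a_{i+1}$ is the $j$-th occurrence of its value. $X_{n,j},Y_{n,j},Z_{n,j}$ are the numbers of $j$-ascents, $j$-descents, $j$-plateaux. *)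

theory Defs
  imports "HOL-Probability.Probability_Mass_Function"
begin

section \<open>Increasing trees\<close>

text \<open>A rooted tree as a directed graph whose edges \<open>(u, v)\<close> point from the parent \<open>u\<close> to the
  child \<open>v\<close>.\<close>

definition rooted_tree :: "'a set \<Rightarrow> 'a \<Rightarrow> ('a \<times> 'a) set \<Rightarrow> bool" where
  "rooted_tree V r E \<longleftrightarrow>
     r \<in> V \<and> E \<subseteq> V \<times> V \<and>
     (\<forall>u. (u, r) \<notin> E) \<and>
     (\<forall>v\<in>V - {r}. \<exists>!u. (u, v) \<in> E) \<and>
     (\<forall>v\<in>V. (r, v) \<in> E\<^sup>*)"

text \<open>A tree with numbered positions is the set of all triples \<open>(u, j, v)\<close> such that the vertex
  \<open>v\<close> is the child occupying position \<open>j\<close> of the vertex \<open>u\<close>.\<close>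

type_synonym pos_tree = "(nat \<times> nat \<times> nat) set"

definition tree_edges :: "pos_tree \<Rightarrow> (nat \<times> nat) set" where
  "tree_edges T = {(u, v). \<exists>j. (u, j, v) \<in> T}"

text \<open>The trees below are \<open>(k + 1)\<close>-ary: the parameter is \<open>k\<close>, and positions are numbered
  \<open>1, \<dots>, k + 1\<close>.\<close>

definition increasing_tree :: "nat \<Rightarrow> nat \<Rightarrow> pos_tree \<Rightarrow> bool" where
  "increasing_tree k n T \<longleftrightarrow>
     T \<subseteq> {1..n} \<times> {1..k + 1} \<times> {1..n} \<and>
     rooted_tree {1..n} 1 (tree_edges T) \<and>
     (\<forall>(u, v)\<in>tree_edges T. u < v) \<and>
     (\<forall>u j v v'. (u, j, v) \<in> T \<and> (u, j, v') \<in> T \<longrightarrow> v = v') \<and>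
     (\<forall>(u, v)\<in>tree_edges T. \<exists>!j. (u, j, v) \<in> T)"

definition increasing_trees :: "nat \<Rightarrow> nat \<Rightarrow> pos_tree set" where
  "increasing_trees k n = {T. increasing_tree k n T}"

definition num_occupying :: "nat \<Rightarrow> nat \<Rightarrow> pos_tree \<Rightarrow> nat" where
  "num_occupying n j T = card {v \<in> {1..n}. \<exists>u. (u, j, v) \<in> T}"

definition num_empty :: "nat \<Rightarrow> nat \<Rightarrow> pos_tree \<Rightarrow> nat" where
  "num_empty n j T = card {u \<in> {1..n}. \<nexists>v. (u, j, v) \<in> T}"

section \<open>Stirling permutations\<close>

text \<open>\<open>entry w i\<close> is \<open>a\<^sub>i\<close> for \<open>0 \<le> i \<le> length w + 1\<close>, where
  \<open>w = [a\<^sub>1, \<dots>, a\<^sub>m]\<close> and \<open>a\<^sub>0 = a\<^sub>m\<^sub>+\<^sub>1 = 0\<close>.\<close>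

definition entry :: "nat list \<Rightarrow> nat \<Rightarrow> nat" where
  "entry w i = (0 # w @ [0]) ! i"

definition stirling_permutation :: "nat \<Rightarrow> nat \<Rightarrow> nat list \<Rightarrow> bool" where
  "stirling_permutation k n w \<longleftrightarrow>
     length w = k * n \<and> set w \<subseteq> {1..n} \<and>
     (\<forall>i\<in>{1..n}. count_list w i = k) \<and>
     (\<forall>p q r. 1 \<le> p \<and> p < q \<and> q < r \<and> r \<le> k * n \<and> entry w p = entry w r \<longrightarrow>
        entry w p \<le> entry w q)"

definition stirling_permutations :: "nat \<Rightarrow> nat \<Rightarrow> nat list set" where
  "stirling_permutations k n = {w. stirling_permutation k n w}"

definition is_ascent :: "nat list \<Rightarrow> nat \<Rightarrow> bool" where
  "is_ascent w i \<longleftrightarrow> i \<le> length w \<and> entry w i < entry w (i + 1)"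

definition is_descent :: "nat list \<Rightarrow> nat \<Rightarrow> bool" where
  "is_descent w i \<longleftrightarrow> i \<le> length w \<and> entry w i > entry w (i + 1)"

definition is_plateau :: "nat list \<Rightarrow> nat \<Rightarrow> bool" where
  "is_plateau w i \<longleftrightarrow> i \<le> length w \<and> entry w i = entry w (i + 1)"

definition num_ascents :: "nat list \<Rightarrow> nat" where
  "num_ascents w = card {i. is_ascent w i}"

definition num_descents :: "nat list \<Rightarrow> nat" where
  "num_descents w = card {i. is_descent w i}"

definition num_plateaux :: "nat list \<Rightarrow> nat" where
  "num_plateaux w = card {i. is_plateau w i}"

text \<open>For \<open>1 \<le> i \<le> length w\<close>, the entry at \<open>i\<close> is the \<open>occurrence w i\<close>-th occurrence
  of its value, counted from the left.\<close>

definition occurrence :: "nat list \<Rightarrow> nat \<Rightarrow> nat" where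
  "occurrence w i = card {p \<in> {1..i}. entry w p = entry w i}"

definition num_j_ascents :: "nat \<Rightarrow> nat list \<Rightarrow> nat" where
  "num_j_ascents j w =
     card {i \<in> {1..length w}. is_ascent w i \<and> occurrence w i = j}"

text \<open>The descent at the last index is not a \<open>j\<close>-descent for any \<open>j\<close>; in a \<open>j\<close>-descent at \<open>i\<close>,
  the occurrence number is that of the entry at \<open>i + 1\<close>.\<close>

definition num_j_descents :: "nat \<Rightarrow> nat list \<Rightarrow> nat" where
  "num_j_descents j w =
     card {i \<in> {1..<length w}. is_descent w i \<and> occurrence w (i + 1) = j}"

definition num_j_plateaux :: "nat \<Rightarrow> nat list \<Rightarrow> nat" where
  "num_j_plateaux j w =
     card {i \<in> {1..length w}. is_plateau w i \<and> occurrence w i = j}"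

section \<open>Uniform random objects\<close>

text \<open>\<open>pmf_of_set\<close> is the uniform distribution only on finite nonempty sets, as here.\<close>

lemma finite_increasing_trees: "finite (increasing_trees k n)"
proof (rule finite_subset)
  show "increasing_trees k n \<subseteq> Pow ({1..n} \<times> {1..k + 1} \<times> {1..n})"
    by (auto simp: increasing_trees_def increasing_tree_def)
qed simp

lemma increasing_trees_nonempty:
  assumes "n \<ge> 1"
  shows "increasing_trees k n \<noteq> {}"
proof -
  define T :: pos_tree where "T = (\<lambda>u. (u, 1, Suc u)) ` {1..<n}"
  have E: "tree_edges T = (\<lambda>u. (u, Suc u)) ` {1..<n}"
    by (auto simp: tree_edges_def T_def)
  have reach: "Suc v \<le> n \<longrightarrow> (1, Suc v) \<in> (tree_edges T)\<^sup>*" for v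
  proof (induction v)
    case (Suc v)
    have "Suc (Suc v) \<le> n \<Longrightarrow> (Suc v, Suc (Suc v)) \<in> tree_edges T"
      unfolding E by auto
    with Suc show ?case by (auto intro: rtrancl_into_rtrancl)
  qed auto
  have "(1, v) \<in> (tree_edges T)\<^sup>*" if "v \<in> {1..n}" for v
    using reach[of "v - 1"] that by auto
  moreover have "\<exists>!u. (u, v) \<in> tree_edges T" if "v \<in> {1..n} - {1}" for v
    using that unfolding E by (intro ex1I[of _ "v - 1"]) (auto simp: image_iff)
  moreover have "tree_edges T \<subseteq> {1..n} \<times> {1..n}" "\<forall>u. (u, 1) \<notin> tree_edges T"
    unfolding E by auto
  ultimately have tree: "rooted_tree {1..n} 1 (tree_edges T)"
    using assms unfolding rooted_tree_def by simp
  have T: "(u, j, v) \<in> T \<longleftrightarrow> u \<in> {1..<n} \<and> j = 1 \<and> v = Suc u" for u j v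
    by (auto simp: T_def)
  have "T \<subseteq> {1..n} \<times> {1..k + 1} \<times> {1..n}"
    by (auto simp: T_def)
  moreover have "\<forall>(u, v)\<in>tree_edges T. u < v"
    unfolding E by auto
  moreover have "\<forall>(u, v)\<in>tree_edges T. \<exists>!j. (u, j, v) \<in> T"
    unfolding E T by auto
  moreover have "\<forall>u j v v'. (u, j, v) \<in> T \<and> (u, j, v') \<in> T \<longrightarrow> v = v'"
    unfolding T by simp
  ultimately have "increasing_tree k n T"
    using tree unfolding increasing_tree_def by blast
  then show ?thesis by (auto simp: increasing_trees_def)
qed

lemma finite_stirling_permutations: "finite (stirling_permutations k n)"
proof (rule finite_subset)
  show "stirling_permutations k n \<subseteq> {w. set w \<subseteq> {1..n} \<and> length w = k * n}"
    by (auto simp: stirling_permutations_def stirling_permutation_def)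
qed (simp add: finite_lists_length_eq)

lemma stirling_permutations_nonempty: "stirling_permutations k n \<noteq> {}"
proof -
  define w where "w = concat (map (replicate k) [1..<Suc n])"
  have len: "length w = k * n"
    by (simp add: w_def length_concat comp_def sum_list_triv)
  have rep: "count_list (replicate k x) i = (if x = i then k else 0)" for x i :: nat
    by (induction k) auto
  have "count_list (concat (map (replicate k) [1..<Suc m])) i = (if i \<in> {1..m} then k else 0)"
    for i m
    by (induction m) (auto simp: rep le_Suc_eq simp del: replicate_Suc)
  then have cnt: "\<forall>i\<in>{1..n}. count_list w i = k"
    unfolding w_def by (simp del: upt_Suc)
  have "sorted (concat (map (replicate k) [1..<Suc m]))" for m
    by (induction m) (auto simp: sorted_append)
  then have srt: "sorted w" unfolding w_def .
  have ent: "entry w p = w ! (p - 1)" if "1 \<le> p" "p \<le> k * n" for p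
    using that by (cases p) (simp_all add: entry_def nth_append len)
  have "entry w p \<le> entry w q" if "1 \<le> p" "p < q" "q < r" "r \<le> k * n" for p q r
  proof -
    from that have "w ! (p - 1) \<le> w ! (q - 1)"
      by (intro sorted_nth_mono[OF srt]) (auto simp: len)
    with that ent[of p] ent[of q] show ?thesis by simp
  qed
  then have "\<forall>p q r. 1 \<le> p \<and> p < q \<and> q < r \<and> r \<le> k * n \<and> entry w p = entry w r \<longrightarrow>
      entry w p \<le> entry w q"
    by blast
  moreover have "set w \<subseteq> {1..n}"
    by (auto simp: w_def simp del: upt_Suc)
  ultimately have "stirling_permutation k n w"
    using len cnt unfolding stirling_permutation_def by blast
  then show ?thesis by (auto simp: stirling_permutations_def)
qed

definition random_tree :: "nat \<Rightarrow> nat \<Rightarrow> pos_tree pmf" where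
  "random_tree k n = pmf_of_set (increasing_trees k n)"

definition random_stirling :: "nat \<Rightarrow> nat \<Rightarrow> nat list pmf" where
  "random_stirling k n = pmf_of_set (stirling_permutations k n)"

end

theory Submission
  imports Defs "HOL-Combinatorics.Transposition"
begin

text \<open>Permuting the positions is a symmetry of the set of increasing trees, so all \<open>D\<^sub>n\<^sub>,\<^sub>j\<close> have the
  same expectation; they sum to \<open>n - 1\<close>, and \<open>L\<^sub>n\<^sub>,\<^sub>j + D\<^sub>n\<^sub>,\<^sub>j = n\<close>.

  A \<open>k\<close>-Stirling permutation of order \<open>n + 1\<close> arises from a unique one of order \<open>n\<close> by inserting the
  block \<open>(n + 1)\<^sup>k\<close> into one of its \<open>kn + 1\<close> gaps. This destroys the chosen gap and creates an ascent,
  \<open>k - 1\<close> plateaux and a descent. If a type of gap gains \<open>a\<^sub>n\<close> in total over all choices of the gap,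
  its expected number satisfies \<open>(kn + 1) e\<^sub>n\<^sub>+\<^sub>1 = kn e\<^sub>n + a\<^sub>n\<close>. Here \<open>a\<^sub>n\<close> is a multiple of \<open>kn + 1\<close>
  for all statistics except \<open>j\<close>-ascents and \<open>j\<close>-descents, where \<open>a\<^sub>n = n\<close> because every value has one
  \<open>j\<close>-th occurrence.\<close>

section \<open>Trees\<close>

definition swap_positions :: "nat \<Rightarrow> nat \<Rightarrow> pos_tree \<Rightarrow> pos_tree" where
  "swap_positions a b T = (\<lambda>(u, i, v). (u, Transposition.transpose a b i, v)) ` T"

text \<open>A transposition is its own inverse, so the label to look up in \<open>T\<close> is given
  by the same transposition.\<close>

lemma mem_swap_positions:
  "(u, i, v) \<in> swap_positions a b T \<longleftrightarrow> (u, Transposition.transpose a b i, v) \<in> T"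
  unfolding swap_positions_def by (force simp: image_iff)

lemma swap_positions_involutory: "swap_positions a b (swap_positions a b T) = T"
  unfolding set_eq_iff by (simp add: mem_swap_positions split_paired_all)

text \<open>The edges forget the positions, so rootedness and the increase of labels carry over
  unchanged. What mentions positions, namely their range and the two uniqueness clauses, is
  transported along the transposition.\<close>

lemma increasing_tree_swap_positions:
  assumes T: "increasing_tree k n T" and ab: "a \<in> {1..k + 1}" "b \<in> {1..k + 1}"
  shows "increasing_tree k n (swap_positions a b T)"
proof -
  let ?t = "Transposition.transpose a b"
  have E: "tree_edges (swap_positions a b T) = tree_edges T"
    unfolding tree_edges_def mem_swap_positions by (metis transpose_involutory)
  have "swap_positions a b T \<subseteq> {1..n} \<times> {1..k + 1} \<times> {1..n}"
    using T ab unfolding increasing_tree_def swap_positions_def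
    by (auto simp: Transposition.transpose_def split: if_splits)
  moreover have "\<exists>!i. (u, ?t i, v) \<in> T" if ex1: "\<exists>!i. (u, i, v) \<in> T" for u v
  proof -
    obtain i where i: "(u, i, v) \<in> T" and un: "\<And>i'. (u, i', v) \<in> T \<Longrightarrow> i' = i"
      using ex1 by blast
    show ?thesis
    proof (rule ex1I[of _ "?t i"])
      show "(u, ?t (?t i), v) \<in> T" using i by simp
      show "i' = ?t i" if "(u, ?t i', v) \<in> T" for i'
        using un[OF that] by (metis transpose_involutory)
    qed
  qed
  ultimately show ?thesis
    using T unfolding increasing_tree_def E by (simp add: mem_swap_positions split_def)
qed

lemma bij_betw_swap_positions:
  assumes "a \<in> {1..k + 1}" "b \<in> {1..k + 1}"
  shows "bij_betw (swap_positions a b) (increasing_trees k n) (increasing_trees k n)"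
proof (rule bij_betw_byWitness[where f' = "swap_positions a b"])
  show "swap_positions a b ` increasing_trees k n \<subseteq> increasing_trees k n"
    using increasing_tree_swap_positions[OF _ assms] unfolding increasing_trees_def by blast
  then show "swap_positions a b ` increasing_trees k n \<subseteq> increasing_trees k n" .
qed (simp_all add: swap_positions_involutory)

lemma num_occupying_swap_positions:
  "num_occupying n i (swap_positions a b T) = num_occupying n (Transposition.transpose a b i) T"
  unfolding num_occupying_def mem_swap_positions ..

section \<open>Occupied and empty positions of a tree\<close>

lemma increasing_tree_rooted_tree:
  "increasing_tree k n T \<Longrightarrow> rooted_tree {1..n} 1 (tree_edges T)"
  unfolding increasing_tree_def by (elim conjE)

lemma increasing_tree_child:
  assumes "increasing_tree k n T" and "(u, i, v) \<in> T"
  shows "v \<in> {1..n} - {1}"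
proof -
  have "(u, v) \<in> tree_edges T"
    using assms by (auto simp: tree_edges_def)
  then show ?thesis
    using increasing_tree_rooted_tree[OF assms(1)] unfolding rooted_tree_def by blast
qed

lemma increasing_tree_parent:
  assumes "increasing_tree k n T" and "v \<in> {1..n} - {1}"
  shows "\<exists>!u. (u, v) \<in> tree_edges T"
  using increasing_tree_rooted_tree[OF assms(1)] assms(2) unfolding rooted_tree_def
  by (elim conjE) (rule bspec)

text \<open>The tree axioms fix the parent, and the last clause of \<open>increasing_tree\<close>
  fixes the position on the edge. Both counts below rest on this.\<close>

lemma increasing_tree_unique_parent:
  assumes T: "increasing_tree k n T" and v: "(u, i, v) \<in> T" "(u', i', v) \<in> T"
  shows "u = u' \<and> i = i'"
proof -
  have E: "(u, v) \<in> tree_edges T" "(u', v) \<in> tree_edges T"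
    using v by (auto simp: tree_edges_def)
  with increasing_tree_parent[OF T increasing_tree_child[OF T v(1)]] have u: "u = u'"
    by blast
  have "\<forall>(u, v)\<in>tree_edges T. \<exists>!j. (u, j, v) \<in> T"
    using T unfolding increasing_tree_def by (elim conjE)
  from bspec[OF this E(1)] have "\<exists>!j. (u, j, v) \<in> T" by simp
  with v u show ?thesis by blast
qed

text \<open>Classifying the non-root vertices by the position they occupy gives a partition, and the
  root occupies no position.\<close>

lemma sum_num_occupying:
  assumes T: "increasing_tree k n T"
  shows "(\<Sum>j\<in>{1..k + 1}. num_occupying n j T) = n - 1"
proof -
  let ?A = "\<lambda>j. {v \<in> {1..n}. \<exists>u. (u, j, v) \<in> T}"
  have "(\<Sum>j\<in>{1..k + 1}. card (?A j)) = card (\<Union>j\<in>{1..k + 1}. ?A j)"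
    using increasing_tree_unique_parent[OF T] by (subst card_UN_disjoint) auto
  also have "(\<Union>j\<in>{1..k + 1}. ?A j) = {1..n} - {1}"
  proof (intro equalityI subsetI)
    fix v assume "v \<in> (\<Union>j\<in>{1..k + 1}. ?A j)"
    then show "v \<in> {1..n} - {1}"
      using increasing_tree_child[OF T] by blast
  next
    fix v assume v: "v \<in> {1..n} - {1}"
    then obtain u j where uj: "(u, j, v) \<in> T"
      using increasing_tree_parent[OF T v] by (auto simp: tree_edges_def)
    have "T \<subseteq> {1..n} \<times> {1..k + 1} \<times> {1..n}"
      using T unfolding increasing_tree_def by (elim conjE)
    with uj have "j \<in> {1..k + 1}" by blast
    with v uj show "v \<in> (\<Union>j\<in>{1..k + 1}. ?A j)" by blast
  qed
  also have "card ({1..n} - {1}) = n - 1"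
    by (cases n) auto
  finally show ?thesis unfolding num_occupying_def .
qed

text \<open>At a fixed position the relation \<open>?R\<close> between parents and children is
  one-to-one, so there are as many vertices having this position occupied as vertices occupying
  it.\<close>

lemma num_empty_plus_num_occupying:
  assumes T: "increasing_tree k n T"
  shows "num_empty n j T + num_occupying n j T = n"
proof -
  let ?R = "{(u, v). (u, j, v) \<in> T}"
  have sub: "?R \<subseteq> {1..n} \<times> {1..n}"
    using T unfolding increasing_tree_def by blast
  have "inj_on fst ?R"
    using T unfolding increasing_tree_def by (auto intro!: inj_onI)
  moreover have "inj_on snd ?R"
    using increasing_tree_unique_parent[OF T] by (auto intro!: inj_onI)
  moreover have "fst ` ?R = {u \<in> {1..n}. \<exists>v. (u, j, v) \<in> T}"
    using sub by force
  moreover have "snd ` ?R = {v \<in> {1..n}. \<exists>u. (u, j, v) \<in> T}"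
    using sub by force
  ultimately have "num_occupying n j T = card {u \<in> {1..n}. \<exists>v. (u, j, v) \<in> T}"
    unfolding num_occupying_def using card_image[of fst ?R] card_image[of snd ?R] by simp
  then have "num_empty n j T + num_occupying n j T =
      card ({u \<in> {1..n}. \<nexists>v. (u, j, v) \<in> T} \<union> {u \<in> {1..n}. \<exists>v. (u, j, v) \<in> T})"
    unfolding num_empty_def by (subst card_Un_disjoint) auto
  also have "{u \<in> {1..n}. \<nexists>v. (u, j, v) \<in> T} \<union> {u \<in> {1..n}. \<exists>v. (u, j, v) \<in> T} = {1..n}"
    by auto
  finally show ?thesis by simp
qed

section \<open>Expectations over increasing trees\<close>

lemma expectation_random_tree:
  assumes "n \<ge> 1"
  shows "measure_pmf.expectation (random_tree k n) f =
    (\<Sum>T\<in>increasing_trees k n. f T) / card (increasing_trees k n)"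
  unfolding random_tree_def
  by (rule integral_pmf_of_set[OF increasing_trees_nonempty[OF assms] finite_increasing_trees])

lemma expectation_num_occupying:
  assumes "n \<ge> 1" and j: "j \<in> {1..k + 1}"
  shows "measure_pmf.expectation (random_tree k n) (\<lambda>T. real (num_occupying n j T))
    = (real n - 1) / (real k + 1)"
proof -
  let ?S = "increasing_trees k n"
  define s where "s i = (\<Sum>T\<in>?S. real (num_occupying n i T))" for i
  have sym: "s i = s j" if "i \<in> {1..k + 1}" for i
  proof -
    \<comment> \<open>Reindexing by the swap of \<open>i\<close> and \<open>j\<close> turns the
      count for \<open>j\<close> into the count for \<open>i\<close>.\<close>
    have "s j = (\<Sum>T\<in>?S. real (num_occupying n j (swap_positions i j T)))"
      unfolding s_def by (rule sum.reindex_bij_betw[symmetric]) (rule bij_betw_swap_positions[OF that j])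
    then show ?thesis unfolding num_occupying_swap_positions s_def by simp
  qed
  have "(real k + 1) * s j = (\<Sum>i\<in>{1..k + 1}. s i)"
    using sym by simp
  also have "\<dots> = (\<Sum>T\<in>?S. real (\<Sum>i\<in>{1..k + 1}. num_occupying n i T))"
    unfolding s_def by (subst sum.swap) simp
  also have "\<dots> = (\<Sum>T\<in>?S. real n - 1)"
    using assms by (intro sum.cong refl, subst sum_num_occupying)
      (auto simp: increasing_trees_def of_nat_diff)
  finally have "(real k + 1) * s j = card ?S * (real n - 1)" by simp
  moreover have "card ?S > 0"
    using increasing_trees_nonempty[OF assms(1)] finite_increasing_trees by (simp add: card_gt_0_iff)
  ultimately show ?thesis
    unfolding expectation_random_tree[OF assms(1)] s_def by (simp add: field_simps)
qed

lemma expectation_num_empty: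
  assumes n: "n \<ge> 1" and j: "j \<in> {1..k + 1}"
  shows "measure_pmf.expectation (random_tree k n) (\<lambda>T. real (num_empty n j T))
    = (real k * real n + 1) / (real k + 1)"
proof -
  let ?S = "increasing_trees k n"
  have c: "card ?S > 0"
    using increasing_trees_nonempty[OF n] finite_increasing_trees by (simp add: card_gt_0_iff)
  have "real (num_empty n j T) = real n - real (num_occupying n j T)" if "T \<in> ?S" for T
    using num_empty_plus_num_occupying[of k n T j] that by (simp add: increasing_trees_def)
  then have "measure_pmf.expectation (random_tree k n) (\<lambda>T. real (num_empty n j T))
    = real n - measure_pmf.expectation (random_tree k n) (\<lambda>T. real (num_occupying n j T))"
    using c by (simp add: expectation_random_tree[OF n] sum_subtractf diff_divide_distrib)
  also have "\<dots> = real n - (real n - 1) / (real k + 1)"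
    by (simp only: expectation_num_occupying[OF n j])
  also have "\<dots> = (real k * real n + 1) / (real k + 1)"
    by (simp add: field_simps)
  finally show ?thesis .
qed

section \<open>Inserting the block of largest entries\<close>

text \<open>Gap \<open>g\<close> lies between the entries numbered \<open>g\<close> and
  \<open>g + 1\<close>, boundary zeros included, so a word has the gaps \<open>0\<close> to
  \<open>length w\<close>.\<close>

definition insert_block :: "nat \<Rightarrow> nat \<Rightarrow> nat list \<Rightarrow> nat \<Rightarrow> nat list" where
  "insert_block k m w g = take g w @ replicate k m @ drop g w"

lemma length_insert_block: "length (insert_block k m w g) = length w + k"
  by (simp add: insert_block_def)

section \<open>Entries and occurrence numbers after an insertion\<close>

lemma entry_0: "entry w 0 = 0"
  by (simp add: entry_def)

lemma entry_Suc_length: "entry w (Suc (length w)) = 0"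
  by (simp add: entry_def nth_append)

lemma entry_in_set: "1 \<le> i \<Longrightarrow> i \<le> length w \<Longrightarrow> entry w i \<in> set w"
  by (cases i) (auto simp: entry_def nth_append)

lemma occurrence_0: "occurrence w 0 = 0"
  by (simp add: occurrence_def)

text \<open>Both padded words begin with the same prefix of length \<open>Suc g\<close>, and
  splitting them there compares them directly. The range of \<open>i\<close> includes the right
  boundary, which the last gap needs.\<close>

lemma entry_insert_block:
  assumes g: "g \<le> length w" and i: "i \<le> Suc (length w + k)"
  shows "entry (insert_block k m w g) i =
    (if i \<le> g then entry w i else if i \<le> g + k then m else entry w (i - k))"
proof -
  have e: "entry w p = ((0 # take g w) @ (drop g w @ [0])) ! p" for p
    unfolding entry_def by (simp flip: append_assoc)
  have e': "entry (insert_block k m w g) i =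
      ((0 # take g w) @ replicate k m @ (drop g w @ [0])) ! i"
    unfolding entry_def insert_block_def by simp
  have l: "length (0 # take g w) = Suc g" using g by simp
  consider "i \<le> g" | "g < i" "i \<le> g + k" | "g + k < i" by linarith
  then show ?thesis
  proof cases
    case 1
    then show ?thesis unfolding e e' nth_append l by simp
  next
    case 2
    then show ?thesis unfolding e' nth_append l by simp
  next
    case 3
    \<comment> \<open>Indexing the two words subtracts the lengths of block and prefix in opposite
      orders.\<close>
    then have "i - k - Suc g = i - Suc g - k" "\<not> i - k < Suc g" by auto
    with 3 show ?thesis unfolding e e' unfolding nth_append l length_replicate by simp
  qed
qed

lemma stirling_permutations_length:
  "w \<in> stirling_permutations k n \<Longrightarrow> length w = k * n"
  by (simp add: stirling_permutations_def stirling_permutation_def)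

lemma entry_pos:
  assumes "w \<in> stirling_permutations k n" "1 \<le> i" "i \<le> k * n"
  shows "1 \<le> entry w i"
  using entry_in_set[of i w] assms
  by (auto simp: stirling_permutations_def stirling_permutation_def)

text \<open>With both boundary zeros included, every entry is strictly below the next value
  \<open>Suc n\<close>. Hence an inserted block always begins after an ascent and ends with a
  descent.\<close>

lemma entry_le:
  assumes w: "w \<in> stirling_permutations k n" and "i \<le> Suc (k * n)"
  shows "entry w i \<le> n"
proof -
  consider "i = 0" | "1 \<le> i" "i \<le> k * n" | "i = Suc (k * n)" using assms by linarith
  then show ?thesis
    using entry_in_set[of i w] w stirling_permutations_length[OF w] entry_Suc_length[of w]
    by cases (auto simp: stirling_permutations_def stirling_permutation_def entry_0)
qed

text \<open>The value \<open>Suc n\<close> is new, so copies of any other value are only shifted,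
  never gained or lost, while the copies in the block are numbered from its left end.\<close>

lemma occurrence_insert_block:
  assumes w: "w \<in> stirling_permutations k n" and g: "g \<le> k * n"
    and i: "i \<le> Suc (k * n + k)"
  shows "occurrence (insert_block k (Suc n) w g) i =
    (if i \<le> g then occurrence w i else if i \<le> g + k then i - g else occurrence w (i - k))"
proof -
  let ?w' = "insert_block k (Suc n) w g"
  have len: "length w = k * n" using w by (rule stirling_permutations_length)
  have e: "entry ?w' p = (if p \<le> g then entry w p else if p \<le> g + k then Suc n else entry w (p - k))"
    if "p \<le> Suc (k * n + k)" for p
    using entry_insert_block[of g w p k "Suc n"] g that len by simp
  have le: "entry w p \<le> n" if "p \<le> Suc (k * n)" for p
    using entry_le[OF w that] .
  consider "i \<le> g" | "g < i" "i \<le> g + k" | "g + k < i" by linarith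
  then show ?thesis
  proof cases
    case 1
    then have "{p \<in> {1..i}. entry ?w' p = entry ?w' i} = {p \<in> {1..i}. entry w p = entry w i}"
      using g i e by auto
    with 1 show ?thesis unfolding occurrence_def by simp
  next
    case 2
    have block: "p \<in> {1..i} \<and> entry ?w' p = Suc n \<longleftrightarrow> p \<in> {Suc g..i}" for p
      using 2 g i e[of p] le[of p] by (auto split: if_splits)
    have "entry ?w' i = Suc n" using 2 i e[of i] by simp
    then have "{p \<in> {1..i}. entry ?w' p = entry ?w' i} = {Suc g..i}"
      by (simp only: block Collect_mem_eq)
    with 2 show ?thesis unfolding occurrence_def by simp
  next
    case 3
    \<comment> \<open>\<open>f\<close> sends a position of \<open>w\<close> to its place after the
      insertion, jumping over the block.\<close>
    define f where "f p = (if p \<le> g then p else p + k)" for p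
    have inj: "inj_on f A" for A by (auto simp: inj_on_def f_def split: if_splits)
    have ei: "entry ?w' i = entry w (i - k)" using 3 i e[of i] by simp
    have "{p \<in> {1..i}. entry ?w' p = entry ?w' i} = f ` {p \<in> {1..i - k}. entry w p = entry w (i - k)}"
    proof (intro equalityI subsetI)
      fix p assume p: "p \<in> {p \<in> {1..i}. entry ?w' p = entry ?w' i}"
      then have ep: "entry ?w' p = entry w (i - k)" and b: "1 \<le> p" "p \<le> i" using ei by auto
      have "entry w (i - k) \<le> n" using le[of "i - k"] i by simp
      with ep e[of p] b i have nb: "p \<le> g \<or> g + k < p" by (auto split: if_splits)
      show "p \<in> f ` {p \<in> {1..i - k}. entry w p = entry w (i - k)}"
      proof (cases "p \<le> g")
        case True
        then show ?thesis using ep e[of p] b i 3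
          by (intro image_eqI[of _ _ p]) (auto simp: f_def)
      next
        case False
        then show ?thesis using ep e[of p] b i 3 nb
          by (intro image_eqI[of _ _ "p - k"]) (auto simp: f_def)
      qed
    next
      fix q assume "q \<in> f ` {p \<in> {1..i - k}. entry w p = entry w (i - k)}"
      then show "q \<in> {p \<in> {1..i}. entry ?w' p = entry ?w' i}"
        using ei e i 3 by (auto simp: f_def)
    qed
    then show ?thesis using 3 unfolding occurrence_def by (simp add: card_image[OF inj])
  qed
qed

section \<open>The insertion bijection\<close>

text \<open>Between two copies of \<open>Suc n\<close> there are only further copies, and a copy of
  \<open>Suc n\<close> between two equal smaller entries is harmless because it is larger. All other
  triples of positions come from \<open>w\<close>.\<close>

lemma insert_block_in_stirling_permutations:
  assumes w: "w \<in> stirling_permutations k n" and g: "g \<le> k * n"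
  shows "insert_block k (Suc n) w g \<in> stirling_permutations k (Suc n)"
proof -
  let ?w' = "insert_block k (Suc n) w g"
  have len: "length w = k * n" using w by (rule stirling_permutations_length)
  have st: "stirling_permutation k n w" using w by (simp add: stirling_permutations_def)
  have e: "entry ?w' p = (if p \<le> g then entry w p else if p \<le> g + k then Suc n else entry w (p - k))"
    if "p \<le> Suc (k * n + k)" for p
    using entry_insert_block[of g w p k "Suc n"] g that len by simp
  have le: "entry w p \<le> n" if "p \<le> Suc (k * n)" for p
    using entry_le[OF w that] .
  have rep: "count_list (replicate k x) i = (if x = i then k else 0)" for x i :: nat
    by (induction k) auto
  have cnt: "count_list w i = count_list (take g w) i + count_list (drop g w) i" for i
    by (metis append_take_drop_id count_list_append)
  have "length ?w' = k * Suc n" by (simp add: length_insert_block len)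
  moreover have "set ?w' \<subseteq> {1..Suc n}"
    using st set_take_subset[of g w] set_drop_subset[of g w]
    by (force simp: insert_block_def stirling_permutation_def)
  moreover have "count_list ?w' i = k" if "i \<in> {1..Suc n}" for i
  proof (cases "i = Suc n")
    case True
    have "Suc n \<notin> set w" using st by (auto simp: stirling_permutation_def)
    then have "count_list w i = 0" using True by simp
    then show ?thesis using True cnt[of i] by (simp add: insert_block_def rep)
  next
    case False
    then have "count_list w i = k" using that st by (auto simp: stirling_permutation_def)
    then show ?thesis using False cnt[of i] by (simp add: insert_block_def rep)
  qed
  moreover have "entry ?w' p \<le> entry ?w' q"
    if pqr: "1 \<le> p" "p < q" "q < r" "r \<le> k * Suc n" "entry ?w' p = entry ?w' r" for p q r
  proof -
    \<comment> \<open>\<open>B\<close> marks the block, and off the block \<open>h\<close> gives the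
      original position in \<open>w\<close>.\<close>
    define h where "h x = (if x \<le> g then x else x - k)" for x
    define B where "B x \<longleftrightarrow> g < x \<and> x \<le> g + k" for x
    have eh: "entry ?w' x = (if B x then Suc n else entry w (h x))" if "x \<le> Suc (k * n + k)" for x
      using e[OF that] by (auto simp: h_def B_def)
    have bd: "p \<le> Suc (k * n + k)" "q \<le> Suc (k * n + k)" "r \<le> Suc (k * n + k)"
      using pqr by auto
    have hle: "h x \<le> Suc (k * n)" if "x \<le> Suc (k * n + k)" for x
      using g that by (auto simp: h_def)
    have iff: "entry ?w' x = Suc n \<longleftrightarrow> B x" if "x \<le> Suc (k * n + k)" for x
      using eh[OF that] le[OF hle[OF that]] by auto
    show ?thesis
    proof (cases "B p")
      case True
      then have "B r" using iff[OF bd(1)] iff[OF bd(3)] pqr by simp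
      with True have "B q" using pqr by (auto simp: B_def)
      with True show ?thesis using iff[OF bd(1)] iff[OF bd(2)] by simp
    next
      case False
      then have np: "\<not> B r" using iff[OF bd(1)] iff[OF bd(3)] pqr by simp
      show ?thesis
      proof (cases "B q")
        case True
        then show ?thesis using False eh[OF bd(1)] eh[OF bd(2)] le[OF hle[OF bd(1)]] by simp
      next
        case nq: False
        have "1 \<le> h p" "h p < h q" "h q < h r" "h r \<le> k * n"
          using pqr False np nq g by (auto simp: h_def B_def)
        moreover have "entry w (h p) = entry w (h r)"
          using pqr(5) eh[OF bd(1)] eh[OF bd(3)] False np by simp
        ultimately have "entry w (h p) \<le> entry w (h q)"
          using st unfolding stirling_permutation_def by blast
        then show ?thesis using eh[OF bd(1)] eh[OF bd(2)] False nq by simp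
      qed
    qed
  qed
  ultimately show ?thesis
    unfolding stirling_permutations_def stirling_permutation_def by blast
qed

text \<open>Deleting all copies of \<open>Suc n\<close> recovers \<open>w\<close>, and the length of
  the prefix before the first copy recovers \<open>g\<close>. The latter needs a nonempty block,
  hence \<open>k \<ge> 1\<close>.\<close>

lemma inj_on_insert_block:
  assumes "k \<ge> 1"
  shows "inj_on (\<lambda>(w, g). insert_block k (Suc n) w g) (stirling_permutations k n \<times> {..k * n})"
proof (rule inj_onI)
  let ?m = "Suc n"
  have flt: "filter (\<lambda>x. x \<noteq> ?m) (insert_block k ?m w g) = w \<and>
      length (takeWhile (\<lambda>x. x \<noteq> ?m) (insert_block k ?m w g)) = g"
    if w: "w \<in> stirling_permutations k n" and g: "g \<in> {..k * n}" for w g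
  proof -
    have nw: "\<forall>x\<in>set w. x \<noteq> ?m"
      using w by (auto simp: stirling_permutations_def stirling_permutation_def)
    then have "\<forall>x\<in>set (take g w). x \<noteq> ?m" "\<forall>x\<in>set (drop g w). x \<noteq> ?m"
      by (meson in_set_takeD in_set_dropD)+
    moreover obtain k' where "k = Suc k'" using assms by (cases k) auto
    ultimately show ?thesis
      using g stirling_permutations_length[OF w]
      by (simp add: insert_block_def takeWhile_append2 filter_id_conv)
  qed
  fix x y
  assume x: "x \<in> stirling_permutations k n \<times> {..k * n}"
    and y: "y \<in> stirling_permutations k n \<times> {..k * n}"
    and eq: "(\<lambda>(w, g). insert_block k ?m w g) x = (\<lambda>(w, g). insert_block k ?m w g) y"
  obtain w g w' g' where xy: "x = (w, g)" "y = (w', g')" by fastforce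
  have "insert_block k ?m w g = insert_block k ?m w' g'" using eq by (simp add: xy)
  moreover have "w \<in> stirling_permutations k n" "g \<in> {..k * n}"
    "w' \<in> stirling_permutations k n" "g' \<in> {..k * n}"
    using x y by (simp_all add: xy)
  ultimately have "w = w'" "g = g'" using flt by metis+
  then show "x = y" by (simp add: xy)
qed

text \<open>Entries between two copies of the largest value are at least that value, hence equal to
  it. So its \<open>k\<close> copies are consecutive, and removing them keeps the Stirling
  condition.\<close>

lemma stirling_permutation_insert_blockE:
  assumes "k \<ge> 1" and w': "w' \<in> stirling_permutations k (Suc n)"
  obtains w g where "w \<in> stirling_permutations k n" "g \<le> k * n" "w' = insert_block k (Suc n) w g"
proof -
  let ?m = "Suc n"
  have st: "stirling_permutation k ?m w'" using w' by (simp add: stirling_permutations_def)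
  have cntm: "count_list w' ?m = k" using st by (auto simp: stirling_permutation_def)
  define u where "u = takeWhile (\<lambda>x. x \<noteq> ?m) w'"
  define t where "t = dropWhile (\<lambda>x. x \<noteq> ?m) w'"
  define c where "c = takeWhile (\<lambda>x. x = ?m) t"
  define v where "v = dropWhile (\<lambda>x. x = ?m) t"
  have w'_eq: "w' = u @ c @ v" by (simp add: u_def t_def c_def v_def)
  have mu: "?m \<notin> set u" unfolding u_def by (auto dest: set_takeWhileD)
  have c_eq: "c = replicate (length c) ?m"
    unfolding c_def by (rule replicate_length_same[symmetric]) (auto dest: set_takeWhileD)
  have mv: "?m \<notin> set v"
  proof
    assume mv: "?m \<in> set v"
    then have v0: "v \<noteq> []" by auto
    then have hv: "hd v \<noteq> ?m" unfolding v_def by (metis (mono_tags) hd_dropWhile)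
    have t0: "t \<noteq> []" using v0 by (auto simp: v_def)
    then have "hd t = ?m" unfolding t_def by (metis (mono_tags, lifting) hd_dropWhile)
    then have c0: "c \<noteq> []" using t0 unfolding c_def by (cases t) auto
    from mv hv obtain s where s: "s < length v" "v ! s = ?m" by (metis in_set_conv_nth)
    have "s \<noteq> 0" using s hv v0 by (metis hd_conv_nth)
    \<comment> \<open>If \<open>?m\<close> recurred after its first run \<open>c\<close>, these
      would be the start of the run, the first entry after it, and a later copy. The Stirling
      condition then forces \<open>hd v\<close> to be \<open>?m\<close>, although the run has ended
      there.\<close>
    define p q r where "p = Suc (length u)" and "q = Suc (length u + length c)"
      and "r = Suc (length u + length c + s)"
    have c0': "c ! 0 = ?m" by (subst c_eq) (use c0 in simp)
    have "entry w' p = ?m"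
      using c0 c0' by (simp add: entry_def w'_eq p_def nth_append)
    moreover have "entry w' q = hd v"
      using v0 by (simp add: entry_def w'_eq q_def nth_append hd_conv_nth)
    moreover have "entry w' r = ?m"
      using s by (simp add: entry_def w'_eq r_def nth_append)
    moreover have "1 \<le> p" "p < q" "q < r" "r \<le> length w'"
      using c0 s \<open>s \<noteq> 0\<close> by (auto simp: p_def q_def r_def w'_eq)
    ultimately have "?m \<le> hd v"
      using st unfolding stirling_permutation_def by metis
    moreover have "hd v \<in> set w'" using v0 by (simp add: w'_eq)
    ultimately show False using hv st by (fastforce simp: stirling_permutation_def)
  qed
  have rep: "count_list (replicate l x) i = (if x = i then l else 0)" for l and x i :: nat
    by (induction l) auto
  have lc: "length c = k"
  proof -
    have "count_list c ?m = length c" by (subst c_eq) (simp add: rep)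
    then show ?thesis using mu mv cntm by (simp add: w'_eq)
  qed
  define w where "w = u @ v"
  define g where "g = length u"
  have ins: "w' = insert_block k ?m w g"
    using c_eq[unfolded lc] by (simp add: insert_block_def w'_eq w_def g_def)
  have len: "length w = k * n"
    using ins length_insert_block[of k ?m w g] st by (simp add: stirling_permutation_def)
  have g: "g \<le> k * n" using len by (simp add: w_def g_def)
  have "set w \<subseteq> {1..n}"
    using st mu mv by (fastforce simp: w_def w'_eq stirling_permutation_def le_Suc_eq)
  moreover have "count_list w i = k" if "i \<in> {1..n}" for i
  proof -
    have "count_list w' i = k" using st that by (auto simp: stirling_permutation_def)
    moreover have "count_list c i = 0" by (subst c_eq) (use that in \<open>simp add: rep\<close>)
    ultimately show ?thesis by (simp add: w_def w'_eq)
  qed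
  moreover have "entry w p \<le> entry w q"
    if pqr: "1 \<le> p" "p < q" "q < r" "r \<le> k * n" "entry w p = entry w r" for p q r
  proof -
    \<comment> \<open>The embedding of positions around the block preserves order, so the condition
      on \<open>w'\<close> restricts to \<open>w\<close>.\<close>
    define f where "f x = (if x \<le> g then x else x + k)" for x
    have ef: "entry w' (f x) = entry w x" if "x \<le> k * n" for x
      unfolding ins using entry_insert_block[of g w "f x" k ?m] g len that assms(1)
      by (auto simp: f_def)
    have "1 \<le> f p" "f p < f q" "f q < f r" "f r \<le> k * ?m"
      using pqr g by (auto simp: f_def)
    moreover have "entry w' (f p) = entry w' (f r)" using pqr ef by simp
    ultimately have "entry w' (f p) \<le> entry w' (f q)"
      using st unfolding stirling_permutation_def by blast
    then show ?thesis using pqr ef by simp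
  qed
  ultimately have "w \<in> stirling_permutations k n"
    using len unfolding stirling_permutations_def stirling_permutation_def by blast
  then show ?thesis using g ins by (rule that)
qed

lemma bij_betw_insert_block:
  assumes "k \<ge> 1"
  shows "bij_betw (\<lambda>(w, g). insert_block k (Suc n) w g)
    (stirling_permutations k n \<times> {..k * n}) (stirling_permutations k (Suc n))"
  unfolding bij_betw_def
proof (intro conjI equalityI subsetI)
  fix w' assume "w' \<in> stirling_permutations k (Suc n)"
  then show "w' \<in> (\<lambda>(w, g). insert_block k (Suc n) w g) ` (stirling_permutations k n \<times> {..k * n})"
    by (rule stirling_permutation_insert_blockE[OF assms]) force
qed (auto intro: inj_on_insert_block[OF assms] insert_block_in_stirling_permutations)

section \<open>Gap statistics\<close>

text \<open>The gap predicates \<open>Q a i b l\<close> see the two entries \<open>a\<close>, \<open>b\<close> around a gap and their occurrence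
  numbers \<open>i\<close>, \<open>l\<close>. The boundary entries are \<open>0\<close>; the left one has occurrence number \<open>0\<close>, but the
  right one has occurrence number \<open>1\<close>.\<close>

definition gap_holds :: "(nat \<Rightarrow> nat \<Rightarrow> nat \<Rightarrow> nat \<Rightarrow> bool) \<Rightarrow> nat list \<Rightarrow> nat \<Rightarrow> bool" where
  "gap_holds Q w i \<longleftrightarrow>
     Q (entry w i) (occurrence w i) (entry w (Suc i)) (occurrence w (Suc i))"

definition num_gaps :: "(nat \<Rightarrow> nat \<Rightarrow> nat \<Rightarrow> nat \<Rightarrow> bool) \<Rightarrow> nat list \<Rightarrow> nat" where
  "num_gaps Q w = card {i \<in> {..length w}. gap_holds Q w i}"

text \<open>The gaps at the left end, inside and at the right end of a block of \<open>k\<close> copies of \<open>m\<close> inserted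
  at gap \<open>g\<close>.\<close>

definition new_gaps :: "(nat \<Rightarrow> nat \<Rightarrow> nat \<Rightarrow> nat \<Rightarrow> bool) \<Rightarrow> nat \<Rightarrow> nat \<Rightarrow> nat list \<Rightarrow> nat \<Rightarrow> nat" where
  "new_gaps Q k m w g =
     of_bool (Q (entry w g) (occurrence w g) m 1) +
     card {j \<in> {1..<k}. Q m j m (Suc j)} +
     of_bool (Q m k (entry w (Suc g)) (occurrence w (Suc g)))"

lemma num_gaps_eq_sum: "num_gaps Q w = (\<Sum>i\<le>length w. of_bool (gap_holds Q w i))"
  by (simp add: num_gaps_def Int_def)

lemma sum_split_point:
  fixes f :: "nat \<Rightarrow> nat"
  assumes "g \<le> N"
  shows "sum f {..N} = sum f {..<g} + f g + sum f {Suc g..N}"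
proof -
  have "{..N} = {..<g} \<union> insert g {Suc g..N}" using assms by auto
  moreover have "sum f ({..<g} \<union> insert g {Suc g..N}) = sum f {..<g} + sum f (insert g {Suc g..N})"
    by (rule sum.union_disjoint) auto
  ultimately show ?thesis by simp
qed

text \<open>The pieces are the gaps after an insertion at \<open>g\<close>: old gaps to the left,
  left end of the block, its inside, its right end, and the shifted old gaps. Since
  \<open>k \<ge> 1\<close>, the two ends are different gaps.\<close>

lemma sum_split_block:
  fixes f :: "nat \<Rightarrow> nat"
  assumes "k \<ge> 1" and "g \<le> N"
  shows "sum f {..N + k} = sum f {..<g} + f g + sum f {Suc g..<g + k} + f (g + k) +
    sum f {g + k + 1..N + k}"
proof -
  have "{..<g + k} = {..<g} \<union> insert g {Suc g..<g + k}" using assms by auto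
  moreover have "sum f ({..<g} \<union> insert g {Suc g..<g + k}) = sum f {..<g} + sum f (insert g {Suc g..<g + k})"
    by (rule sum.union_disjoint) auto
  ultimately show ?thesis using sum_split_point[of "g + k" "N + k" f] assms by simp
qed

text \<open>All gaps other than \<open>g\<close> keep their neighbours and occurrence numbers. The
  destroyed gap is added on the left to avoid subtraction of natural numbers.\<close>

lemma num_gaps_insert_block:
  assumes k: "k \<ge> 1" and w: "w \<in> stirling_permutations k n" and g: "g \<le> k * n"
  shows "num_gaps Q (insert_block k (Suc n) w g) + of_bool (gap_holds Q w g) =
    num_gaps Q w + new_gaps Q k (Suc n) w g"
proof -
  let ?m = "Suc n" and ?w' = "insert_block k (Suc n) w g"
  let ?P = "\<lambda>i. of_bool (gap_holds Q w i) :: nat" and ?P' = "\<lambda>i. of_bool (gap_holds Q ?w' i) :: nat"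
  have len: "length w = k * n" using w by (rule stirling_permutations_length)
  have e: "entry ?w' p = (if p \<le> g then entry w p else if p \<le> g + k then ?m else entry w (p - k))"
    if "p \<le> Suc (k * n + k)" for p
    using entry_insert_block[of g w p k ?m] g that len by simp
  note o = occurrence_insert_block[OF w g]
  have "(\<Sum>i\<le>length ?w'. ?P' i) = (\<Sum>i<g. ?P' i) + ?P' g + (\<Sum>i=Suc g..<g + k. ?P' i) +
      ?P' (g + k) + (\<Sum>i=g + k + 1..k * n + k. ?P' i)"
    unfolding length_insert_block len by (rule sum_split_block[OF k g])
  also have "(\<Sum>i<g. ?P' i) = (\<Sum>i<g. ?P i)"
    using g by (intro sum.cong) (auto simp: gap_holds_def e o)
  also have "?P' g = of_bool (Q (entry w g) (occurrence w g) ?m 1)"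
    using g k by (simp add: gap_holds_def e o)
  \<comment> \<open>Inside the block, \<open>j = i - g\<close> is the occurrence number of the left
    neighbour.\<close>
  also have "(\<Sum>i=Suc g..<g + k. ?P' i) = (\<Sum>j=1..<k. of_bool (Q ?m j ?m (Suc j)))"
    using g by (intro sum.reindex_bij_witness[of _ "\<lambda>j. j + g" "\<lambda>i. i - g"])
      (auto simp: gap_holds_def e o Suc_diff_le)
  also have "\<dots> = card {j \<in> {1..<k}. Q ?m j ?m (Suc j)}"
    by (simp add: Int_def)
  also have "?P' (g + k) = of_bool (Q ?m k (entry w (Suc g)) (occurrence w (Suc g)))"
    using g k by (simp add: gap_holds_def e o)
  also have "(\<Sum>i=g + k + 1..k * n + k. ?P' i) = (\<Sum>i=Suc g..k * n. ?P i)"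
    using g by (intro sum.reindex_bij_witness[of _ "\<lambda>j. j + k" "\<lambda>i. i - k"])
      (auto simp: gap_holds_def e o Suc_diff_le)
  finally have new: "num_gaps Q ?w' =
      (\<Sum>i<g. ?P i) + new_gaps Q k ?m w g + (\<Sum>i=Suc g..k * n. ?P i)"
    unfolding num_gaps_eq_sum new_gaps_def by simp
  have "(\<Sum>i\<le>length w. ?P i) = (\<Sum>i<g. ?P i) + ?P g + (\<Sum>i=Suc g..k * n. ?P i)"
    unfolding len by (rule sum_split_point[OF g])
  then show ?thesis using new unfolding num_gaps_eq_sum by simp
qed

section \<open>Counting the occurrences with a given number\<close>

lemma stirling_permutations_0: "stirling_permutations k 0 = {[]}"
  by (auto simp: stirling_permutations_def stirling_permutation_def)

text \<open>By induction on insertions: wherever the block goes, the new gaps make up for the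
  destroyed gap and contribute one more.\<close>

lemma num_gaps_eq_order:
  assumes k: "k \<ge> 1" and w: "w \<in> stirling_permutations k n"
    and base: "num_gaps Q [] = 0"
    and step: "\<And>n w g. w \<in> stirling_permutations k n \<Longrightarrow> g \<le> k * n \<Longrightarrow>
      new_gaps Q k (Suc n) w g = Suc (of_bool (gap_holds Q w g))"
  shows "num_gaps Q w = n"
  using w
proof (induction n arbitrary: w)
  case 0
  then show ?case using base by (simp add: stirling_permutations_0)
next
  case (Suc n)
  then obtain v g where v: "v \<in> stirling_permutations k n" "g \<le> k * n" "w = insert_block k (Suc n) v g"
    using stirling_permutation_insert_blockE[OF k] by metis
  then show ?case using num_gaps_insert_block[OF k v(1,2), of Q] step[OF v(1,2)] Suc.IH[OF v(1)]
    by simp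
qed


text \<open>Each of the \<open>n\<close> values has one \<open>j\<close>-th occurrence. Identifying
  it with the gap to its right makes the induction on insertions applicable.\<close>

lemma sum_occurrence:
  assumes k: "k \<ge> 1" and w: "w \<in> stirling_permutations k n" and j: "j \<in> {1..k}"
  shows "(\<Sum>g\<le>k * n. of_bool (occurrence w g = j)) = n"
proof -
  define Q :: "nat \<Rightarrow> nat \<Rightarrow> nat \<Rightarrow> nat \<Rightarrow> bool" where "Q a i b l \<longleftrightarrow> i = j" for a i b l
  have "num_gaps Q w = n"
  proof (rule num_gaps_eq_order[OF k w])
    show "num_gaps Q [] = 0"
      using j by (simp add: num_gaps_eq_sum gap_holds_def Q_def occurrence_0 del: sum_of_bool_eq)
    fix n v g
    \<comment> \<open>The gap to the right of the \<open>j\<close>-th copy is inside the block,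
      except for \<open>j = k\<close>, where it is the right end of the block.\<close>
    have "{i \<in> {1..<k}. i = j} = (if j = k then {} else {j})" using j by auto
    then show "new_gaps Q k (Suc n) v g = Suc (of_bool (gap_holds Q v g))"
      by (simp add: new_gaps_def gap_holds_def Q_def)
  qed
  then show ?thesis
    unfolding num_gaps_eq_sum stirling_permutations_length[OF w] gap_holds_def Q_def .
qed

text \<open>The same count with each occurrence identified with the gap to its left. The condition
  \<open>0 < entry w (Suc g)\<close> excludes the right boundary zero, whose occurrence number is
  1.\<close>

lemma sum_occurrence_Suc:
  assumes k: "k \<ge> 1" and w: "w \<in> stirling_permutations k n" and j: "j \<in> {1..k}"
  shows "(\<Sum>g\<le>k * n. of_bool (0 < entry w (Suc g) \<and> occurrence w (Suc g) = j)) = n"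
proof -
  define Q :: "nat \<Rightarrow> nat \<Rightarrow> nat \<Rightarrow> nat \<Rightarrow> bool" where "Q a i b l \<longleftrightarrow> 0 < b \<and> l = j" for a i b l
  have "num_gaps Q w = n"
  proof (rule num_gaps_eq_order[OF k w])
    show "num_gaps Q [] = 0"
      using entry_Suc_length[of "[]"] by (simp add: num_gaps_eq_sum gap_holds_def Q_def del: sum_of_bool_eq)
    fix n v g
    \<comment> \<open>For \<open>j = 1\<close> the gap before the \<open>j\<close>-th copy is the
      left end of the block; otherwise it is an inner gap.\<close>
    have "{i \<in> {1..<k}. Suc i = j} = (if j = 1 then {} else {j - 1})" using j by auto
    then show "new_gaps Q k (Suc n) v g = Suc (of_bool (gap_holds Q v g))"
      by (simp add: new_gaps_def gap_holds_def Q_def)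
  qed
  then show ?thesis
    unfolding num_gaps_eq_sum stirling_permutations_length[OF w] gap_holds_def Q_def .
qed

section \<open>Expectations over Stirling permutations\<close>

lemma expectation_random_stirling:
  "measure_pmf.expectation (random_stirling k n) f =
    (\<Sum>w\<in>stirling_permutations k n. f w) / card (stirling_permutations k n)"
  unfolding random_stirling_def
  by (rule integral_pmf_of_set[OF stirling_permutations_nonempty finite_stirling_permutations])

text \<open>As \<open>g\<close> runs over the \<open>k * n + 1\<close> gaps, each old gap is
  destroyed exactly once and survives \<open>k * n\<close> times.\<close>

lemma sum_num_gaps_insert_block:
  assumes k: "k \<ge> 1" and w: "w \<in> stirling_permutations k n"
  shows "(\<Sum>g\<le>k * n. real (num_gaps Q (insert_block k (Suc n) w g))) =
    real (k * n) * real (num_gaps Q w) + real (\<Sum>g\<le>k * n. new_gaps Q k (Suc n) w g)"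
proof -
  have "(\<Sum>g\<le>k * n. num_gaps Q (insert_block k (Suc n) w g)) + num_gaps Q w =
      (\<Sum>g\<le>k * n. num_gaps Q (insert_block k (Suc n) w g) + of_bool (gap_holds Q w g))"
    unfolding sum.distrib
    by (simp only: num_gaps_eq_sum[of Q w] stirling_permutations_length[OF w])
  also have "\<dots> = (\<Sum>g\<le>k * n. num_gaps Q w + new_gaps Q k (Suc n) w g)"
    using num_gaps_insert_block[OF k w] by (intro sum.cong) auto
  also have "\<dots> = Suc (k * n) * num_gaps Q w + (\<Sum>g\<le>k * n. new_gaps Q k (Suc n) w g)"
    by (simp add: sum.distrib)
  finally have "(\<Sum>g\<le>k * n. num_gaps Q (insert_block k (Suc n) w g)) =
      k * n * num_gaps Q w + (\<Sum>g\<le>k * n. new_gaps Q k (Suc n) w g)"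
    by simp
  then show ?thesis by (metis of_nat_add of_nat_mult of_nat_sum)
qed

text \<open>The insertion bijection turns the sum over order \<open>Suc n\<close> into a double sum
  over words and gaps. The recurrence closes because the total gain \<open>a\<close> is the same for
  every \<open>w\<close>.\<close>

lemma expectation_num_gaps_Suc:
  assumes k: "k \<ge> 1"
    and new: "\<And>w. w \<in> stirling_permutations k n \<Longrightarrow>
      real (\<Sum>g\<le>k * n. new_gaps Q k (Suc n) w g) = a"
  shows "measure_pmf.expectation (random_stirling k (Suc n)) (\<lambda>w. real (num_gaps Q w)) =
    (real (k * n) * measure_pmf.expectation (random_stirling k n) (\<lambda>w. real (num_gaps Q w)) + a) /
      (real (k * n) + 1)"
proof -
  let ?S = "stirling_permutations k n"
  note bij = bij_betw_insert_block[OF k, of n]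
  have card: "card (stirling_permutations k (Suc n)) = card ?S * Suc (k * n)"
    using bij_betw_same_card[OF bij] by (simp add: card_cartesian_product)
  have "(\<Sum>w\<in>stirling_permutations k (Suc n). real (num_gaps Q w)) =
      (\<Sum>(w, g)\<in>?S \<times> {..k * n}. real (num_gaps Q (insert_block k (Suc n) w g)))"
    by (subst sum.reindex_bij_betw[OF bij, symmetric]) (simp add: split_def)
  also have "\<dots> = (\<Sum>w\<in>?S. \<Sum>g\<le>k * n. real (num_gaps Q (insert_block k (Suc n) w g)))"
    by (rule sum.cartesian_product[symmetric])
  also have "\<dots> = (\<Sum>w\<in>?S. real (k * n) * real (num_gaps Q w) + a)"
    by (intro sum.cong refl) (simp only: sum_num_gaps_insert_block[OF k] new)
  also have "\<dots> = real (k * n) * (\<Sum>w\<in>?S. real (num_gaps Q w)) + card ?S * a"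
    by (simp add: sum.distrib sum_distrib_left)
  finally have total: "(\<Sum>w\<in>stirling_permutations k (Suc n). real (num_gaps Q w)) =
      real (k * n) * (\<Sum>w\<in>?S. real (num_gaps Q w)) + card ?S * a" .
  have c: "real (card ?S) \<noteq> 0"
    using stirling_permutations_nonempty finite_stirling_permutations by (simp add: card_gt_0_iff)
  have "(m * t + C * a) / (C * (1 + m)) = (m * (t / C) + a) / (m + 1)"
    if "C \<noteq> 0" "m \<ge> 0" for m t C :: real
    using that by (simp add: field_simps)
  from this[OF c of_nat_0_le_iff] show ?thesis
    unfolding expectation_random_stirling total card of_nat_mult[of "card ?S"] of_nat_Suc .
qed

text \<open>The constant \<open>c\<close> is the average number of new gaps of the given type per
  insertion: 1 for ascents, for descents and for each kind of \<open>j\<close>-plateau, and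
  \<open>k - 1\<close> for all plateaux.\<close>

lemma expectation_num_gaps_gap_count:
  assumes k: "k \<ge> 1" and n: "n \<ge> 1"
    and new: "\<And>n w. w \<in> stirling_permutations k n \<Longrightarrow>
      real (\<Sum>g\<le>k * n. new_gaps Q k (Suc n) w g) = c * (real (k * n) + 1)"
  shows "measure_pmf.expectation (random_stirling k n) (\<lambda>w. real (num_gaps Q w)) =
    c * ((real k * real n + 1) / (real k + 1))"
  using n
proof (induction n rule: nat_induct_at_least)
  case base
  \<comment> \<open>At order 0 the coefficient \<open>k * 0\<close> removes the old expectation and
    leaves \<open>c\<close>. The closed form itself need not hold at order 0.\<close>
  show ?case using expectation_num_gaps_Suc[OF k new, of 0] by simp
next
  case (Suc n)
  have "measure_pmf.expectation (random_stirling k (Suc n)) (\<lambda>w. real (num_gaps Q w)) =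
    (real (k * n) * measure_pmf.expectation (random_stirling k n) (\<lambda>w. real (num_gaps Q w)) +
      c * (real (k * n) + 1)) / (real (k * n) + 1)"
    by (rule expectation_num_gaps_Suc[OF k new])
  also have "\<dots> = (real (k * n) * (c * ((real k * real n + 1) / (real k + 1))) +
      c * (real (k * n) + 1)) / (real (k * n) + 1)"
    by (simp only: Suc.IH)
  also have "\<dots> = c * ((real k * real (Suc n) + 1) / (real k + 1))"
  proof -
    \<comment> \<open>With \<open>x = k * n + 1\<close> and \<open>y = k + 1\<close>, the sum
      \<open>x - 1 + y\<close> is \<open>k * Suc n + 1\<close>.\<close>
    have "((x - 1) * (c * (x / y)) + c * x) / x = c * ((x - 1 + y) / y)"
      if "x > 0" "y > 0" for x y :: real
      using that by (simp add: field_simps)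
    from this[of "real k * real n + 1" "real k + 1"] show ?thesis
      by (simp add: add_pos_nonneg add_nonneg_pos algebra_simps)
  qed
  finally show ?case .
qed

text \<open>Serves \<open>j\<close>-ascents and \<open>j\<close>-descents. The recurrence gives 0 at
  order 1, and its step rests on the factorization of \<open>k * n * (n - 1) + n * (k + 1)\<close>
  as \<open>n * (k * n + 1)\<close>.\<close>

lemma expectation_num_gaps_order:
  assumes k: "k \<ge> 1" and n: "n \<ge> 1"
    and new: "\<And>n w. w \<in> stirling_permutations k n \<Longrightarrow>
      (\<Sum>g\<le>k * n. new_gaps Q k (Suc n) w g) = n"
  shows "measure_pmf.expectation (random_stirling k n) (\<lambda>w. real (num_gaps Q w)) =
    (real n - 1) / (real k + 1)"
  using n
proof (induction n rule: nat_induct_at_least)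
  case base
  show ?case using expectation_num_gaps_Suc[OF k, of 0 Q 0] new[of _ 0] by simp
next
  case (Suc n)
  have "measure_pmf.expectation (random_stirling k (Suc n)) (\<lambda>w. real (num_gaps Q w)) =
    (real (k * n) * measure_pmf.expectation (random_stirling k n) (\<lambda>w. real (num_gaps Q w)) + n) /
      (real (k * n) + 1)"
    by (rule expectation_num_gaps_Suc[OF k]) (simp only: new)
  also have "\<dots> = (real (k * n) * ((real n - 1) / (real k + 1)) + n) / (real (k * n) + 1)"
    by (simp only: Suc.IH)
  also have "\<dots> = (real (Suc n) - 1) / (real k + 1)"
  proof -
    have "(x * y * ((y - 1) / (x + 1)) + y) / (x * y + 1) = y / (x + 1)"
      if "x \<ge> 0" "y \<ge> 0" for x y :: real
    proof -
      have "x * y + 1 > 0" "x + 1 > 0" using that by (simp_all add: add_nonneg_pos)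
      moreover from this have "x * y * ((y - 1) / (x + 1)) + y = (x * y + 1) * (y / (x + 1))"
        by (simp add: field_simps)
      ultimately show ?thesis by simp
    qed
    from this[of "real k" "real n"] show ?thesis by simp
  qed
  finally show ?case .
qed

section \<open>The statistics as gap counts\<close>

lemma num_ascents_eq_num_gaps: "num_ascents w = num_gaps (\<lambda>a i b l. a < b) w"
  unfolding num_ascents_def num_gaps_def gap_holds_def is_ascent_def
  by (intro arg_cong[of _ _ card]) auto

lemma num_descents_eq_num_gaps: "num_descents w = num_gaps (\<lambda>a i b l. b < a) w"
  unfolding num_descents_def num_gaps_def gap_holds_def is_descent_def
  by (intro arg_cong[of _ _ card]) auto

lemma num_plateaux_eq_num_gaps: "num_plateaux w = num_gaps (\<lambda>a i b l. a = b) w"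
  unfolding num_plateaux_def num_gaps_def gap_holds_def is_plateau_def
  by (intro arg_cong[of _ _ card]) auto

text \<open>Gap 0 is among the gaps but not among the indices of \<open>num_j_ascents\<close>. Its
  left occurrence number is 0, so \<open>j \<ge> 1\<close> rules it out.\<close>

lemma num_j_ascents_eq_num_gaps:
  assumes "j \<ge> 1"
  shows "num_j_ascents j w = num_gaps (\<lambda>a i b l. a < b \<and> i = j) w"
  unfolding num_j_ascents_def num_gaps_def gap_holds_def is_ascent_def
  by (intro arg_cong[of _ _ card]) (use assms occurrence_0[of w] in \<open>auto simp: Suc_le_eq intro!: gr0I\<close>)

lemma num_j_plateaux_eq_num_gaps:
  assumes "j \<ge> 1"
  shows "num_j_plateaux j w = num_gaps (\<lambda>a i b l. a = b \<and> i = j) w"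
  unfolding num_j_plateaux_def num_gaps_def gap_holds_def is_plateau_def
  by (intro arg_cong[of _ _ card]) (use assms occurrence_0[of w] in \<open>auto simp: Suc_le_eq intro!: gr0I\<close>)

text \<open>The condition \<open>0 < b\<close> excludes the last gap, whose right neighbour is the
  boundary zero, and gap 0 is never a descent. At every other gap the right neighbour is a genuine,
  hence positive, entry.\<close>

lemma num_j_descents_eq_num_gaps:
  assumes w: "w \<in> stirling_permutations k n"
  shows "num_j_descents j w = num_gaps (\<lambda>a i b l. b < a \<and> 0 < b \<and> l = j) w"
proof -
  have len: "length w = k * n" using w by (rule stirling_permutations_length)
  have pos: "1 \<le> i \<and> i < length w \<longleftrightarrow> i \<le> length w \<and> 0 < entry w (Suc i)"
    if "entry w (Suc i) < entry w i" for i
  proof (cases "i < length w")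
    case True
    moreover have "i \<noteq> 0" using that by (metis entry_0 not_less0)
    ultimately show ?thesis using entry_pos[OF w, of "Suc i"] by (simp add: len)
  next
    case False
    then show ?thesis using entry_Suc_length[of w] by (auto simp: le_less)
  qed
  show ?thesis
    unfolding num_j_descents_def num_gaps_def gap_holds_def is_descent_def
    by (intro arg_cong[of _ _ card] set_eqI) (use pos in auto)
qed

theorem theorem5p2:
  fixes k n :: nat
  assumes "k \<ge> 1" and "n \<ge> 1"
  shows
    "(\<forall>j\<in>{1..k + 1}.
        measure_pmf.expectation (random_tree k n) (\<lambda>T. real (num_empty n j T))
          = (real k * real n + 1) / (real k + 1)) \<and>
     (\<forall>j\<in>{1..k + 1}.
        measure_pmf.expectation (random_tree k n) (\<lambda>T. real (num_occupying n j T))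
          = (real n - 1) / (real k + 1)) \<and>
     (\<forall>j\<in>{1..k}.
        measure_pmf.expectation (random_stirling k n) (\<lambda>w. real (num_j_ascents j w))
          = (real n - 1) / (real k + 1) \<and>
        measure_pmf.expectation (random_stirling k n) (\<lambda>w. real (num_j_descents j w))
          = (real n - 1) / (real k + 1)) \<and>
     (\<forall>j\<in>{1..k - 1}.
        measure_pmf.expectation (random_stirling k n) (\<lambda>w. real (num_j_plateaux j w))
          = (real k * real n + 1) / (real k + 1)) \<and>
     measure_pmf.expectation (random_stirling k n) (\<lambda>w. real (num_ascents w))
       = (real k * real n + 1) / (real k + 1) \<and>
     measure_pmf.expectation (random_stirling k n) (\<lambda>w. real (num_descents w))
       = (real k * real n + 1) / (real k + 1) \<and>
     measure_pmf.expectation (random_stirling k n) (\<lambda>w. real (num_plateaux w))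
       = (real k - 1) * ((real k * real n + 1) / (real k + 1))"
proof (intro conjI ballI)
  fix j assume "j \<in> {1..k + 1}"
  then show "measure_pmf.expectation (random_tree k n) (\<lambda>T. real (num_empty n j T))
      = (real k * real n + 1) / (real k + 1)"
    and "measure_pmf.expectation (random_tree k n) (\<lambda>T. real (num_occupying n j T))
      = (real n - 1) / (real k + 1)"
    by (rule expectation_num_empty[OF assms(2)] expectation_num_occupying[OF assms(2)])+
next
  fix j assume j: "j \<in> {1..k}"
  then have "j \<ge> 1" by simp
  show "measure_pmf.expectation (random_stirling k n) (\<lambda>w. real (num_j_ascents j w))
      = (real n - 1) / (real k + 1)"
    unfolding num_j_ascents_eq_num_gaps[OF \<open>j \<ge> 1\<close>]
  proof (rule expectation_num_gaps_order[OF assms])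
    fix n w assume w: "w \<in> stirling_permutations k n"
    \<comment> \<open>The only new ascent is at the left end of the block, and its left neighbour is
      the entry at \<open>g\<close>.\<close>
    have "new_gaps (\<lambda>a i b l. a < b \<and> i = j) k (Suc n) w g = of_bool (occurrence w g = j)"
      if "g \<le> k * n" for g
      using entry_le[OF w, of g] entry_le[OF w, of "Suc g"] that by (simp add: new_gaps_def)
    then show "(\<Sum>g\<le>k * n. new_gaps (\<lambda>a i b l. a < b \<and> i = j) k (Suc n) w g) = n"
      using sum_occurrence[OF assms(1) w j] by (metis (no_types, lifting) atMost_iff sum.cong)
  qed
  have "measure_pmf.expectation (random_stirling k n) (\<lambda>w. real (num_j_descents j w)) =
      measure_pmf.expectation (random_stirling k n)
        (\<lambda>w. real (num_gaps (\<lambda>a i b l. b < a \<and> 0 < b \<and> l = j) w))"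
    \<comment> \<open>The translation to gaps is available for Stirling permutations, so it is
      applied under the sum over them.\<close>
    unfolding expectation_random_stirling by (simp add: num_j_descents_eq_num_gaps)
  also have "\<dots> = (real n - 1) / (real k + 1)"
  proof (rule expectation_num_gaps_order[OF assms])
    fix n w assume w: "w \<in> stirling_permutations k n"
    \<comment> \<open>The only new descent is at the right end of the block; it counts if the entry
      after \<open>g\<close> is not the boundary zero and has occurrence number
      \<open>j\<close>.\<close>
    have "new_gaps (\<lambda>a i b l. b < a \<and> 0 < b \<and> l = j) k (Suc n) w g =
        of_bool (0 < entry w (Suc g) \<and> occurrence w (Suc g) = j)"
      if "g \<le> k * n" for g
      using entry_le[OF w, of g] entry_le[OF w, of "Suc g"] that by (simp add: new_gaps_def)
    then show "(\<Sum>g\<le>k * n. new_gaps (\<lambda>a i b l. b < a \<and> 0 < b \<and> l = j) k (Suc n) w g) = n"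
      using sum_occurrence_Suc[OF assms(1) w j] by (metis (no_types, lifting) atMost_iff sum.cong)
  qed
  finally show "measure_pmf.expectation (random_stirling k n) (\<lambda>w. real (num_j_descents j w))
      = (real n - 1) / (real k + 1)" .
next
  fix j assume j: "j \<in> {1..k - 1}"
  then have "j \<ge> 1" by simp
  have "measure_pmf.expectation (random_stirling k n) (\<lambda>w. real (num_j_plateaux j w))
      = 1 * ((real k * real n + 1) / (real k + 1))"
    unfolding num_j_plateaux_eq_num_gaps[OF \<open>j \<ge> 1\<close>]
  proof (rule expectation_num_gaps_gap_count[OF assms])
    fix n w assume w: "w \<in> stirling_permutations k n"
    \<comment> \<open>The new plateaux lie inside the block, one after each copy but the last, so
      \<open>j \<le> k - 1\<close> yields exactly one \<open>j\<close>-plateau.\<close>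
    have "{i \<in> {1..<k}. i = j} = {j}" using j by auto
    then have "new_gaps (\<lambda>a i b l. a = b \<and> i = j) k (Suc n) w g = 1" if "g \<le> k * n" for g
      using entry_le[OF w, of g] entry_le[OF w, of "Suc g"] that by (simp add: new_gaps_def)
    then show "real (\<Sum>g\<le>k * n. new_gaps (\<lambda>a i b l. a = b \<and> i = j) k (Suc n) w g)
        = 1 * (real (k * n) + 1)"
      by simp
  qed
  then show "measure_pmf.expectation (random_stirling k n) (\<lambda>w. real (num_j_plateaux j w))
      = (real k * real n + 1) / (real k + 1)"
    by simp
next
  have "measure_pmf.expectation (random_stirling k n) (\<lambda>w. real (num_ascents w))
      = 1 * ((real k * real n + 1) / (real k + 1))"
    unfolding num_ascents_eq_num_gaps
  proof (rule expectation_num_gaps_gap_count[OF assms])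
    fix n w assume w: "w \<in> stirling_permutations k n"
    have "new_gaps (\<lambda>a i b l. a < b) k (Suc n) w g = 1" if "g \<le> k * n" for g
      using entry_le[OF w, of g] entry_le[OF w, of "Suc g"] that by (simp add: new_gaps_def)
    then show "real (\<Sum>g\<le>k * n. new_gaps (\<lambda>a i b l. a < b) k (Suc n) w g)
        = 1 * (real (k * n) + 1)"
      by simp
  qed
  then show "measure_pmf.expectation (random_stirling k n) (\<lambda>w. real (num_ascents w))
      = (real k * real n + 1) / (real k + 1)"
    by simp
next
  have "measure_pmf.expectation (random_stirling k n) (\<lambda>w. real (num_descents w))
      = 1 * ((real k * real n + 1) / (real k + 1))"
    unfolding num_descents_eq_num_gaps
  proof (rule expectation_num_gaps_gap_count[OF assms])
    fix n w assume w: "w \<in> stirling_permutations k n"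
    have "new_gaps (\<lambda>a i b l. b < a) k (Suc n) w g = 1" if "g \<le> k * n" for g
      using entry_le[OF w, of g] entry_le[OF w, of "Suc g"] that by (simp add: new_gaps_def)
    then show "real (\<Sum>g\<le>k * n. new_gaps (\<lambda>a i b l. b < a) k (Suc n) w g)
        = 1 * (real (k * n) + 1)"
      by simp
  qed
  then show "measure_pmf.expectation (random_stirling k n) (\<lambda>w. real (num_descents w))
      = (real k * real n + 1) / (real k + 1)"
    by simp
next
  show "measure_pmf.expectation (random_stirling k n) (\<lambda>w. real (num_plateaux w))
      = (real k - 1) * ((real k * real n + 1) / (real k + 1))"
    unfolding num_plateaux_eq_num_gaps
  proof (rule expectation_num_gaps_gap_count[OF assms])
    fix n w assume w: "w \<in> stirling_permutations k n"
    have "{i. Suc 0 \<le> i \<and> i < k} = {1..<k}" by auto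
    then have "new_gaps (\<lambda>a i b l. a = b) k (Suc n) w g = k - 1" if "g \<le> k * n" for g
      using entry_le[OF w, of g] entry_le[OF w, of "Suc g"] that by (simp add: new_gaps_def)
    then have "(\<Sum>g\<le>k * n. new_gaps (\<lambda>a i b l. a = b) k (Suc n) w g) = (k * n + 1) * (k - 1)"
      by simp
    also have "real \<dots> = (real k - 1) * (real (k * n) + 1)"
      \<comment> \<open>The hypothesis \<open>k \<ge> 1\<close> is what turns \<open>k - 1\<close>
        on natural numbers into the real difference.\<close>
      using assms(1) by (simp only: of_nat_mult of_nat_add of_nat_diff of_nat_1 mult.commute)
    finally show "real (\<Sum>g\<le>k * n. new_gaps (\<lambda>a i b l. a = b) k (Suc n) w g)
        = (real k - 1) * (real (k * n) + 1)" .
  qed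
qed

end
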